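(* Let $B,L,\mu>0$ and let $\ell:\mathcal{Y}^2\to[0,\infty)$ be a loss function such that (1) $\ell(\hat y,y)\le B$ for all $\hat y,y\in\mathcal{Y}$; (2) $|\ell(\hat y,y)-\ell(\hat y',y)|\le L|\hat y-\hat y'|$ for all $y,\hat y,\hat y'\in\mathcal{Y}$; (3) for all $y\in\mathcal{Y}$, the map $\hat y\mapsto \ell(\hat y,y)-\frac{\mu}{2}\hat y^2$ is convex on $\mathcal{Y}$. Then for all integers $M,n\ge 1$, every temperature $T\in(0,\infty)$ satisfying $\frac{L^2}{T}\exp(B/T)\le \frac{\mu}{2}$, every dictionary $\mathcal{F}=\{f_1,\ldots,f_M\}$ of measurable functions $f_k:\mathcal{X}\to\mathcal{Y}$, and every probability distribution $P$ on $\mathcal{X}\times\mathcal{Y}$, the aggregation with exponential weights estimator $\hat f_T$, computed from an i.i.d. sample $\mathbf{S}\sim P^n$, satisfies $$\mathbb{E}_{\mathbf{S}\sim P^n}\left[\mathcal{R}_P(\hat f_T)\right]\le \min_{1\le k\le M}\mathcal{R}_P(f_k)+\frac{T\log M}{n+1}.$$ Moreover, for the squared loss $\ell(\hat y,y)=(\hat y-y)^2$ on $\mathcal{Y}=[0,b]$ with $b>0$, the same conclusion holds with the condition $\frac{L^2}{T}\exp(B/T)\le \frac{\mu}{2}$ replaced by $T\in[4b^2,\infty)$.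
   Context: $(\mathcal{X},\Sigma)$ is an arbitrary measurable space, $\mathcal{Y}\subset\mathbb{R}$ is convex with its Borel $\sigma$-algebra $\mathcal{B}(\mathcal{Y})$, and $P$ is a probability distribution on $(\mathcal{X}\times\mathcal{Y},\Sigma\otimes\mathcal{B}(\mathcal{Y}))$. The loss $\ell$ is measurable on $\mathcal{Y}^2$, so that risks are well defined. A dictionary $\{f_1,\ldots,f_M\}$ is a finite indexed family (repetitions allowed). The risk of a measurable $f:\mathcal{X}\to\mathcal{Y}$ is $\mathcal{R}_P(f)=\mathbb{E}_{(X,Y)\sim P}[\ell(f(X),Y)]$. For a sample $\mathbf{S}=(X_i,Y_i)_{i=1}^n$ drawn i.i.d. from $P$, the empirical risk is $\widehat{\mathcal{R}}_{\mathbf{S}}(f)=\frac1n\sum_{i=1}^n\ell(f(X_i),Y_i)$. The aggregation with exponential weights (AEW) estimator with temperature $T>0$ is $$\hat f_T=\sum_{k=1}^M\hat\theta_k f_k,\qquad \hat\theta_k=\frac{\exp\left(-\frac{n}{T}\widehat{\mathcal{R}}_{\mathbf{S}}(f_k)\right)}{\sum_{j=1}^M\exp\left(-\frac{n}{T}\widehat{\mathcal{R}}_{\mathbf{S}}(f_j)\right)},\quad k\in\{1,\ldots,M\}.$$ $\log$ is the natural logarithm. *)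

theory Defs
  imports "HOL-Probability.Probability"
begin

text \<open>
  Predictors are total functions from the feature type to \<^typ>\<open>real\<close>, and losses are total functions on
  pairs of reals; only their values on the feature space and on the label set \<open>Y\<close> are relevant.
  Dictionaries and samples are indexed from \<open>1\<close>, so a sample of size \<open>n\<close> is a point of
  \<open>\<Pi>\<^sub>M i\<in>{1..n}. P\<close>.
\<close>

abbreviation borel_on :: "real set \<Rightarrow> real measure" where
  "borel_on Y \<equiv> restrict_space borel Y"

definition risk :: "(real \<Rightarrow> real \<Rightarrow> real) \<Rightarrow> ('a \<times> real) measure \<Rightarrow> ('a \<Rightarrow> real) \<Rightarrow> real" where
  "risk l P f = (\<integral>z. l (f (fst z)) (snd z) \<partial>P)"

definition empirical_risk ::
  "(real \<Rightarrow> real \<Rightarrow> real) \<Rightarrow> nat \<Rightarrow> (nat \<Rightarrow> 'a \<times> real) \<Rightarrow> ('a \<Rightarrow> real) \<Rightarrow> real" where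
  "empirical_risk l n S f = 1 / real n * (\<Sum>i=1..n. l (f (fst (S i))) (snd (S i)))"

definition aew_weight ::
  "(real \<Rightarrow> real \<Rightarrow> real) \<Rightarrow> nat \<Rightarrow> nat \<Rightarrow> real \<Rightarrow> (nat \<Rightarrow> 'a \<Rightarrow> real) \<Rightarrow> (nat \<Rightarrow> 'a \<times> real) \<Rightarrow> nat \<Rightarrow> real"
  where
  "aew_weight l M n T f S k =
     exp (- (real n / T) * empirical_risk l n S (f k)) /
     (\<Sum>j=1..M. exp (- (real n / T) * empirical_risk l n S (f j)))"

definition aew ::
  "(real \<Rightarrow> real \<Rightarrow> real) \<Rightarrow> nat \<Rightarrow> nat \<Rightarrow> real \<Rightarrow> (nat \<Rightarrow> 'a \<Rightarrow> real) \<Rightarrow> (nat \<Rightarrow> 'a \<times> real) \<Rightarrow> 'a \<Rightarrow> real"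
  where
  "aew l M n T f S = (\<lambda>x. \<Sum>k=1..M. aew_weight l M n T f S k * f k x)"

end

theory Submission
  imports Defs
begin

text \<open>
  The bound comes from leave-one-out symmetry. Draw \<open>n + 1\<close> points instead of \<open>n\<close>. By exchangeability
  the expected risk of the aggregate is the expected average, over the \<open>n + 1\<close> points, of the loss at
  point \<open>i\<close> of the aggregate trained on the other \<open>n\<close>. It is therefore enough to bound the sum of these
  held-out losses for each fixed configuration of \<open>n + 1\<close> points; this is \<open>sum_held_out_loss_le\<close>.

  Let \<open>W k\<close> be the total loss of \<open>f k\<close> over all \<open>n + 1\<close> points and let \<open>\<pi>\<close> be the Gibbs weights
  proportional to \<open>exp (- W k / T)\<close>. The weights \<open>\<theta>\<close> that leave out point \<open>i\<close> and the weights \<open>\<pi>\<close>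
  differ by a single exponential tilt: \<open>\<pi> k\<close> is proportional to \<open>\<theta> k * exp (- loss k i / T)\<close>. Suppose
  the loss of the \<open>\<theta>\<close>-mean prediction is at most the \<open>\<pi>\<close>-average of the losses (this is
  \<open>tilted_jensen\<close>). Then every held-out loss is at most an average with the same weights
  \<open>\<pi>\<close>, and the held-out losses sum to at most the \<open>\<pi>\<close>-mean of \<open>W\<close>. The Gibbs variational principle
  bounds that mean by \<open>W k + T * ln M\<close> for each \<open>k\<close> (\<open>gibbs_mean_le\<close>). Taking expectations and
  dividing by \<open>n + 1\<close> gives the theorem.

  The tilt moves weight to predictions with small loss, so the tilted inequality is stronger than
  Jensen's. Curvature pays for the difference. For a \<open>\<mu>\<close>-strongly convex loss the Jensen gap is at
  least \<open>\<mu> / 2\<close> times the \<open>\<theta>\<close>-variance of the predictions, while the tilt costs at most \<open>L\<^sup>2 / T\<close>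
  times that variance, up to the factor \<open>exp (B / T)\<close>. For the squared loss this estimate would not
  reach \<open>T = 4 * b\<^sup>2\<close>; there the inequality holds because the tilted loss difference lies above its
  tangent line at the mean.
\<close>

section \<open>Jensen's inequality under an exponential tilt\<close>

text \<open>
  All that the leave-one-out argument uses about the loss and the temperature. It is Jensen's inequality
  with one side averaged under tilted weights instead of \<open>\<theta>\<close>; the normalizing constant of the tilted
  weights is multiplied out so that no division occurs.
\<close>

definition tilted_jensen :: "real set \<Rightarrow> (real \<Rightarrow> real \<Rightarrow> real) \<Rightarrow> real \<Rightarrow> bool" where
  "tilted_jensen Y l T \<longleftrightarrow>
     (\<forall>y\<in>Y. \<forall>(I :: nat set) \<theta> u. finite I \<longrightarrow> (\<forall>k\<in>I. 0 \<le> \<theta> k) \<longrightarrow> (\<Sum>k\<in>I. \<theta> k) = 1 \<longrightarrow> (\<forall>k\<in>I. u k \<in> Y) \<longrightarrow>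
        l (\<Sum>k\<in>I. \<theta> k * u k) y * (\<Sum>k\<in>I. \<theta> k * exp (- (l (u k) y / T)))
          \<le> (\<Sum>k\<in>I. \<theta> k * exp (- (l (u k) y / T)) * l (u k) y))"

lemma abs_exp_neg_diff_le:
  fixes a b :: real
  assumes "0 \<le> a" "0 \<le> b"
  shows "\<bar>exp (- a) - exp (- b)\<bar> \<le> \<bar>a - b\<bar>"
proof -
  have *: "exp (- s) - exp (- t) \<le> t - s" if "0 \<le> s" "s \<le> t" for s t :: real
  proof -
    have "exp (- s) - exp (- t) = exp (- s) * (1 - exp (- (t - s)))"
      by (simp add: algebra_simps flip: exp_add)
    also have "\<dots> \<le> 1 * (1 - exp (- (t - s)))"
      using that by (intro mult_right_mono) auto
    also have "\<dots> \<le> t - s"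
      using exp_minus_ge[of "t - s"] by simp
    finally show ?thesis .
  qed
  show ?thesis
  proof (cases "a \<le> b")
    case True
    moreover from this have "exp (- b) \<le> exp (- a)" by simp
    ultimately show ?thesis using *[of a b] assms by linarith
  next
    case False
    moreover from this have "exp (- a) \<le> exp (- b)" by simp
    ultimately show ?thesis using *[of b a] assms by linarith
  qed
qed

text \<open>
  Write \<open>m\<close> for the mean, \<open>d k\<close> for the excess loss of \<open>u k\<close> over \<open>m\<close>, and \<open>w\<close> for the tilt. In
  \<open>w (u k) * d k = w m * d k + (w (u k) - w m) * d k\<close> the first term averages, by strong convexity,
  to at least \<open>w m * \<mu> / 2\<close> times the variance of the predictions. The second term is quadratic in \<open>d k\<close>, as
  \<open>w\<close> is \<open>1 / T\<close>-Lipschitz in the loss, and hence at least \<open>- L\<^sup>2 / T * (u k - m)\<^sup>2\<close>. The condition on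
  \<open>T\<close> balances the two because \<open>w m \<ge> exp (- B / T)\<close>.
\<close>

lemma tilted_jensen_if_strongly_convex:
  fixes l :: "real \<Rightarrow> real \<Rightarrow> real"
  assumes Y: "convex Y"
    and nonneg: "\<And>u y. u \<in> Y \<Longrightarrow> y \<in> Y \<Longrightarrow> 0 \<le> l u y"
    and bounded: "\<And>u y. u \<in> Y \<Longrightarrow> y \<in> Y \<Longrightarrow> l u y \<le> B"
    and lipschitz: "\<And>u v y. u \<in> Y \<Longrightarrow> v \<in> Y \<Longrightarrow> y \<in> Y \<Longrightarrow> \<bar>l u y - l v y\<bar> \<le> L * \<bar>u - v\<bar>"
    and convex: "\<And>y. y \<in> Y \<Longrightarrow> convex_on Y (\<lambda>u. l u y - \<mu> / 2 * u\<^sup>2)"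
    and \<mu>: "\<mu> > 0"
    and T: "T > 0" "L\<^sup>2 / T * exp (B / T) \<le> \<mu> / 2"
  shows "tilted_jensen Y l T"
  unfolding tilted_jensen_def
proof (intro ballI allI impI)
  fix y and I :: "nat set" and \<theta> u :: "nat \<Rightarrow> real"
  assume y: "y \<in> Y" and I: "finite I" and \<theta>: "\<forall>k\<in>I. 0 \<le> \<theta> k" "sum \<theta> I = 1"
    and u: "\<forall>k\<in>I. u k \<in> Y"
  define m where "m = (\<Sum>k\<in>I. \<theta> k * u k)"
  define V where "V = (\<Sum>k\<in>I. \<theta> k * (u k - m)\<^sup>2)"
  define w where "w v = exp (- (l v y / T))" for v
  define d where "d k = l (u k) y - l m y" for k
  have "I \<noteq> {}" using \<theta>(2) by auto
  have m: "m \<in> Y"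
    using convex_sum[OF I Y, of \<theta> u] \<theta> u by (simp add: m_def)
  have "0 \<le> V" unfolding V_def using \<theta> by (intro sum_nonneg) auto
  have "V = (\<Sum>k\<in>I. \<theta> k * (u k)\<^sup>2) - 2 * m * (\<Sum>k\<in>I. \<theta> k * u k) + m\<^sup>2 * (\<Sum>k\<in>I. \<theta> k)"
    unfolding V_def
    unfolding sum_distrib_left sum_subtractf[symmetric] sum.distrib[symmetric]
    by (intro sum.cong refl) algebra
  then have V: "(\<Sum>k\<in>I. \<theta> k * (u k)\<^sup>2) = V + m\<^sup>2"
    using \<theta>(2) by (simp flip: m_def add: power2_eq_square)
  have "l m y - \<mu> / 2 * m\<^sup>2 \<le> (\<Sum>k\<in>I. \<theta> k * (l (u k) y - \<mu> / 2 * (u k)\<^sup>2))"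
    using convex_on_sum[OF I \<open>I \<noteq> {}\<close> convex[OF y] \<theta>(2), of u] \<theta> u by (simp add: m_def)
  also have "\<dots> = (\<Sum>k\<in>I. \<theta> k * l (u k) y) - \<mu> / 2 * (\<Sum>k\<in>I. \<theta> k * (u k)\<^sup>2)"
    by (simp add: right_diff_distrib sum_subtractf sum_distrib_left mult_ac)
  finally have "\<mu> / 2 * V \<le> (\<Sum>k\<in>I. \<theta> k * l (u k) y) - l m y"
    by (simp add: V algebra_simps)
  also have "\<dots> = (\<Sum>k\<in>I. \<theta> k * d k)"
    using \<theta>(2) by (simp add: d_def right_diff_distrib sum_subtractf flip: sum_distrib_right)
  finally have jensen: "\<mu> / 2 * V \<le> (\<Sum>k\<in>I. \<theta> k * d k)" .
  have termwise: "w m * d k - L\<^sup>2 / T * (u k - m)\<^sup>2 \<le> w (u k) * d k" if k: "k \<in> I" for k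
  proof -
    have "\<bar>w (u k) - w m\<bar> \<le> \<bar>l (u k) y / T - l m y / T\<bar>"
      unfolding w_def using nonneg u k m y T by (intro abs_exp_neg_diff_le) auto
    also have "\<dots> = \<bar>d k\<bar> / T"
      using T by (simp add: d_def flip: diff_divide_distrib)
    finally have "\<bar>(w (u k) - w m) * d k\<bar> \<le> \<bar>d k\<bar> / T * \<bar>d k\<bar>"
      unfolding abs_mult by (intro mult_right_mono) auto
    also have "\<dots> = (d k)\<^sup>2 / T" by (simp add: power2_eq_square)
    also have "\<dots> \<le> (L * \<bar>u k - m\<bar>)\<^sup>2 / T"
      unfolding power2_abs[of "d k", symmetric]
      using lipschitz u k m y T unfolding d_def by (intro divide_right_mono power_mono) auto
    finally have "\<bar>(w (u k) - w m) * d k\<bar> \<le> L\<^sup>2 / T * (u k - m)\<^sup>2"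
      by (simp add: power_mult_distrib)
    then have "- (L\<^sup>2 / T * (u k - m)\<^sup>2) \<le> (w (u k) - w m) * d k" by linarith
    then show ?thesis by (simp add: left_diff_distrib)
  qed
  have "L\<^sup>2 / T \<le> exp (- (B / T)) * (\<mu> / 2)"
    using T(2) by (simp add: exp_minus field_simps)
  also have "\<dots> \<le> w m * (\<mu> / 2)"
    unfolding w_def using bounded[OF m y] T \<mu> by (intro mult_right_mono) (auto simp: divide_right_mono)
  finally have "L\<^sup>2 / T * V \<le> w m * (\<mu> / 2) * V"
    using \<open>0 \<le> V\<close> by (rule mult_right_mono)
  also have "\<dots> \<le> w m * (\<Sum>k\<in>I. \<theta> k * d k)"
    unfolding mult.assoc by (intro mult_left_mono jensen) (simp add: w_def)
  finally have "0 \<le> w m * (\<Sum>k\<in>I. \<theta> k * d k) - L\<^sup>2 / T * V" by simp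
  also have "\<dots> = (\<Sum>k\<in>I. \<theta> k * (w m * d k - L\<^sup>2 / T * (u k - m)\<^sup>2))"
    unfolding V_def sum_distrib_left sum_subtractf[symmetric] by (intro sum.cong refl) algebra
  also have "\<dots> \<le> (\<Sum>k\<in>I. \<theta> k * (w (u k) * d k))"
    using termwise \<theta> by (intro sum_mono mult_left_mono) auto
  also have "\<dots> = (\<Sum>k\<in>I. \<theta> k * w (u k) * l (u k) y) - l m y * (\<Sum>k\<in>I. \<theta> k * w (u k))"
    unfolding d_def sum_distrib_left sum_subtractf[symmetric] by (intro sum.cong refl) algebra
  finally show "l (\<Sum>k\<in>I. \<theta> k * u k) y * (\<Sum>k\<in>I. \<theta> k * exp (- (l (u k) y / T)))
      \<le> (\<Sum>k\<in>I. \<theta> k * exp (- (l (u k) y / T)) * l (u k) y)"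
    by (simp add: w_def m_def)
qed

text \<open>
  The right-hand side, as a function of \<open>g\<close>, vanishes at \<open>g = m\<close>, and the left-hand side is its
  tangent there. It need not be convex on \<open>[- b, b]\<close> when \<open>T = 4 * b\<^sup>2\<close>, so the tangent bound is
  checked by hand. Dividing out \<open>g - m\<close>, it compares \<open>(g + m) * exp (- (g\<^sup>2 - m\<^sup>2) / T)\<close> with
  \<open>2 * m\<close>, and \<open>1 + x \<le> exp x\<close> reduces this to \<open>(g + m)\<^sup>2 \<le> T\<close> for \<open>g \<ge> m \<ge> 0\<close> and to
  \<open>2 * m * (m + g) \<le> T\<close> for \<open>- m < g < m\<close>.
\<close>

lemma gaussian_tilt_tangent:
  fixes g m :: real
  assumes T: "T > 0" "4 * b\<^sup>2 \<le> T" and g: "\<bar>g\<bar> \<le> b" and m: "\<bar>m\<bar> \<le> b"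
  shows "2 * m * (g - m) * exp (- (m\<^sup>2 / T)) \<le> (g\<^sup>2 - m\<^sup>2) * exp (- (g\<^sup>2 / T))"
proof -
  have *: "2 * m * (g - m) * exp (- (m\<^sup>2 / T)) \<le> (g\<^sup>2 - m\<^sup>2) * exp (- (g\<^sup>2 / T))"
    if "0 \<le> m" "\<bar>g\<bar> \<le> b" "m \<le> b" for g m :: real
  proof -
    define E where "E = exp (- (m\<^sup>2 / T))"
    define F where "F = exp (- (g\<^sup>2 / T))"
    have pos: "0 < E" "0 < F" by (simp_all add: E_def F_def)
    have F: "F = exp (- ((g\<^sup>2 - m\<^sup>2) / T)) * E" and E: "E = exp (- ((m\<^sup>2 - g\<^sup>2) / T)) * F"
      by (simp_all add: E_def F_def diff_divide_distrib flip: exp_add)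
    have "2 * m * (g - m) * E \<le> (g\<^sup>2 - m\<^sup>2) * F"
    proof (cases "m \<le> g")
      case True
      have "(g + m)\<^sup>2 \<le> (2 * b)\<^sup>2" using that True by (intro power_mono) auto
      then have "(g + m)\<^sup>2 / T \<le> 1" using T by (simp add: power_mult_distrib)
      then have "(g - m) * ((g + m)\<^sup>2 / T) \<le> (g - m) * 1"
        using True by (intro mult_left_mono) auto
      then have "2 * m \<le> (g + m) * (1 - (g\<^sup>2 - m\<^sup>2) / T)"
        by (simp add: power2_eq_square algebra_simps add_divide_distrib diff_divide_distrib)
      also have "\<dots> \<le> (g + m) * exp (- ((g\<^sup>2 - m\<^sup>2) / T))"
        using that True exp_ge_add_one_self[of "- ((g\<^sup>2 - m\<^sup>2) / T)"]
        by (intro mult_left_mono) auto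
      finally have "2 * m * E \<le> (g + m) * exp (- ((g\<^sup>2 - m\<^sup>2) / T)) * E"
        using pos by (intro mult_right_mono) auto
      then have "2 * m * E \<le> (g + m) * F" by (simp add: F mult.assoc)
      then have "(g - m) * (2 * m * E) \<le> (g - m) * ((g + m) * F)"
        using True by (intro mult_left_mono) auto
      then show ?thesis by (simp add: power2_eq_square algebra_simps)
    next
      case False
      have "(g + m) * F \<le> 2 * m * E"
      proof (cases "g + m \<le> 0")
        case True
        then have "(g + m) * F \<le> 0" using pos by (simp add: mult_nonpos_nonneg)
        also have "0 \<le> 2 * m * E" using that pos by simp
        finally show ?thesis .
      next
        case gm: False
        have "2 * m * (m + g) \<le> (2 * b) * (2 * b)"
          using that gm False by (intro mult_mono) auto
        then have "2 * m * (m + g) / T \<le> 1" using T by (simp add: power2_eq_square)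
        then have "(m - g) * (2 * m * (m + g) / T) \<le> (m - g) * 1"
          using False by (intro mult_left_mono) auto
        then have "g + m \<le> 2 * m * (1 - (m\<^sup>2 - g\<^sup>2) / T)"
          by (simp add: power2_eq_square algebra_simps add_divide_distrib diff_divide_distrib)
        also have "\<dots> \<le> 2 * m * exp (- ((m\<^sup>2 - g\<^sup>2) / T))"
          using that exp_ge_add_one_self[of "- ((m\<^sup>2 - g\<^sup>2) / T)"]
          by (intro mult_left_mono) auto
        finally have "(g + m) * F \<le> 2 * m * exp (- ((m\<^sup>2 - g\<^sup>2) / T)) * F"
          using pos by (intro mult_right_mono) auto
        then show ?thesis by (simp add: E mult.assoc)
      qed
      then have "(m - g) * ((g + m) * F) \<le> (m - g) * (2 * m * E)"
        using False by (intro mult_left_mono) auto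
      then show ?thesis by (simp add: power2_eq_square algebra_simps)
    qed
    then show ?thesis by (simp add: E_def F_def)
  qed
  \<comment> \<open>Both sides are invariant under changing the signs of \<open>g\<close> and \<open>m\<close> together.\<close>
  show ?thesis
  proof (cases "0 \<le> m")
    case True
    then show ?thesis using *[of m g] g m by simp
  next
    case False
    then show ?thesis using *[of "- m" "- g"] g m by (simp add: algebra_simps)
  qed
qed

lemma tilted_jensen_square:
  assumes b: "b > 0" and T: "4 * b\<^sup>2 \<le> T"
  shows "tilted_jensen {0..b} (\<lambda>u y. (u - y)\<^sup>2) T"
  unfolding tilted_jensen_def
proof (intro ballI allI impI)
  fix y and I :: "nat set" and \<theta> u :: "nat \<Rightarrow> real"
  assume y: "y \<in> {0..b}" and I: "finite I" and \<theta>: "\<forall>k\<in>I. 0 \<le> \<theta> k" "sum \<theta> I = 1"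
    and u: "\<forall>k\<in>I. u k \<in> {0..b}"
  have "0 < 4 * b\<^sup>2" using b by simp
  then have "T > 0" using T by linarith
  define v where "v = (\<Sum>k\<in>I. \<theta> k * u k)"
  have v: "v \<in> {0..b}"
    using convex_sum[OF I, of "{0..b}" \<theta> u] \<theta> u by (simp add: v_def)
  define w where "w k = exp (- ((u k - y)\<^sup>2 / T))" for k
  define c where "c = 2 * (v - y) * exp (- ((v - y)\<^sup>2 / T))"
  have "0 = c * ((\<Sum>k\<in>I. \<theta> k * u k) - v * (\<Sum>k\<in>I. \<theta> k))"
    using \<theta>(2) by (simp add: v_def)
  also have "\<dots> = (\<Sum>k\<in>I. \<theta> k * (c * (u k - v)))"
    unfolding sum_distrib_left sum_subtractf[symmetric] by (intro sum.cong refl) algebra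
  also have "\<dots> \<le> (\<Sum>k\<in>I. \<theta> k * (((u k - y)\<^sup>2 - (v - y)\<^sup>2) * w k))"
  proof (intro sum_mono mult_left_mono)
    fix k assume "k \<in> I"
    then have "u k \<in> {0..b}" using u by auto
    then have "\<bar>u k - y\<bar> \<le> b" "\<bar>v - y\<bar> \<le> b" using v y by auto
    from gaussian_tilt_tangent[OF \<open>T > 0\<close> T this]
    show "c * (u k - v) \<le> ((u k - y)\<^sup>2 - (v - y)\<^sup>2) * w k"
      by (simp add: c_def w_def mult_ac)
  qed (use \<theta> in auto)
  also have "\<dots> = (\<Sum>k\<in>I. \<theta> k * w k * (u k - y)\<^sup>2) - (v - y)\<^sup>2 * (\<Sum>k\<in>I. \<theta> k * w k)"
    unfolding sum_distrib_left sum_subtractf[symmetric] by (intro sum.cong refl) algebra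
  finally show "((\<Sum>k\<in>I. \<theta> k * u k) - y)\<^sup>2 * (\<Sum>k\<in>I. \<theta> k * exp (- ((u k - y)\<^sup>2 / T)))
      \<le> (\<Sum>k\<in>I. \<theta> k * exp (- ((u k - y)\<^sup>2 / T)) * (u k - y)\<^sup>2)"
    by (simp add: w_def v_def)
qed

section \<open>Leave-one-out bound for a fixed configuration of points\<close>

text \<open>
  For the Gibbs weights \<open>p\<close> with partition function \<open>Z\<close>, the identity \<open>S j = - T * ln (p j) - T * ln Z\<close>
  shows that the \<open>p\<close>-mean of \<open>S\<close> is \<open>T\<close> times the entropy of \<open>p\<close> minus \<open>T * ln Z\<close>. The entropy is at
  most \<open>ln (card I)\<close>, and \<open>Z\<close> is at least its \<open>k\<close>-th summand.
\<close>

lemma gibbs_mean_le: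
  fixes S :: "nat \<Rightarrow> real"
  assumes I: "finite I" and T: "T > 0" and k: "k \<in> I"
  shows "(\<Sum>j\<in>I. exp (- (S j / T)) * S j)
    \<le> (S k + T * ln (real (card I))) * (\<Sum>j\<in>I. exp (- (S j / T)))"
proof -
  define Z where "Z = (\<Sum>j\<in>I. exp (- (S j / T)))"
  define p where "p j = exp (- (S j / T)) / Z" for j
  define N where "N = real (card I)"
  have N: "N > 0" unfolding N_def using I k by (auto simp: card_gt_0_iff)
  have Zk: "exp (- (S k / T)) \<le> Z"
    unfolding Z_def using I k by (intro member_le_sum) auto
  have Z: "Z > 0" using Zk exp_gt_zero[of "- (S k / T)"] by linarith
  have p: "p j > 0" for j using Z by (simp add: p_def)
  have p1: "(\<Sum>j\<in>I. p j) = 1" using Z by (simp add: p_def Z_def flip: sum_divide_distrib)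
  \<comment> \<open>Summed over \<open>j\<close>, the terms \<open>1 / N - p j\<close> cancel; what remains is the entropy bound.\<close>
  have "p j * (S j / T) \<le> p j * (ln N - ln Z) + (1 / N - p j)" if "j \<in> I" for j
  proof -
    have "ln (1 / (N * p j)) \<le> 1 / (N * p j) - 1" using N p by (intro ln_le_minus_one) auto
    then have "p j * ln (1 / (N * p j)) \<le> p j * (1 / (N * p j) - 1)"
      using p[of j] by (intro mult_left_mono) auto
    also have "\<dots> = 1 / N - p j" using N p[of j] by (simp add: field_simps)
    also have "ln (1 / (N * p j)) = S j / T + ln Z - ln N"
      using N Z p[of j] by (simp add: ln_div ln_mult p_def)
    finally show ?thesis by (simp add: algebra_simps)
  qed
  then have "(\<Sum>j\<in>I. p j * (S j / T)) \<le> (\<Sum>j\<in>I. p j * (ln N - ln Z) + (1 / N - p j))"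
    by (rule sum_mono)
  also have "\<dots> = ln N - ln Z"
    using p1 N by (simp add: sum.distrib sum_subtractf N_def flip: sum_distrib_right)
  finally have "(\<Sum>j\<in>I. p j * (S j / T)) \<le> ln N - ln Z" .
  moreover have "- (S k / T) \<le> ln Z" using Zk Z by (simp add: ln_ge_iff)
  ultimately have "(\<Sum>j\<in>I. p j * (S j / T)) \<le> S k / T + ln N" by simp
  also have "(\<Sum>j\<in>I. p j * (S j / T)) = (\<Sum>j\<in>I. exp (- (S j / T)) * S j) / (Z * T)"
    by (simp add: p_def sum_divide_distrib)
  finally have "(\<Sum>j\<in>I. exp (- (S j / T)) * S j) \<le> (S k / T + ln N) * (Z * T)"
    using Z T by (simp add: pos_divide_le_eq)
  also have "\<dots> = (S k + T * ln N) * Z" using T by (simp add: field_simps)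
  finally show ?thesis by (simp add: Z_def N_def)
qed

lemma aew_weight_pos: "M \<ge> 1 \<Longrightarrow> aew_weight l M n T f S k > 0"
  unfolding aew_weight_def by (intro divide_pos_pos sum_pos) auto

lemma sum_aew_weight: "M \<ge> 1 \<Longrightarrow> (\<Sum>k=1..M. aew_weight l M n T f S k) = 1"
proof -
  assume "M \<ge> 1"
  then have "(\<Sum>j=1..M. exp (- (real n / T) * empirical_risk l n S (f j))) > 0"
    by (intro sum_pos) auto
  then show ?thesis unfolding aew_weight_def by (simp flip: sum_divide_distrib)
qed

lemma aew_mem_convex:
  assumes "convex Y" "M \<ge> 1" "\<And>k. k \<in> {1..M} \<Longrightarrow> f k x \<in> Y"
  shows "aew l M n T f S x \<in> Y"
  using convex_sum[of "{1..M}" Y "aew_weight l M n T f S" "\<lambda>k. f k x"]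
    assms aew_weight_pos[of M l n T f S] sum_aew_weight[of M l n T f S]
  by (simp add: aew_def less_imp_le)

text \<open>
  Only the last of the \<open>n + 1\<close> points is ever held out. Holding out point \<open>i\<close> is expressed by first
  moving it to the last position, so that exchangeability applies to one fixed function of the points.
\<close>

definition held_out_loss ::
  "(real \<Rightarrow> real \<Rightarrow> real) \<Rightarrow> nat \<Rightarrow> nat \<Rightarrow> real \<Rightarrow> (nat \<Rightarrow> 'a \<Rightarrow> real) \<Rightarrow> (nat \<Rightarrow> 'a \<times> real) \<Rightarrow> real"
  where
  "held_out_loss l M n T f S = l (aew l M n T f S (fst (S (Suc n)))) (snd (S (Suc n)))"

abbreviation swap_last :: "nat \<Rightarrow> nat \<Rightarrow> nat \<Rightarrow> nat" where
  "swap_last n i \<equiv> Transposition.transpose i (Suc n)"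

text \<open>
  A training sum that omits point \<open>i\<close> is the sum over all points minus the loss at \<open>i\<close>. Written this way,
  the weights for different \<open>i\<close> are tilts of one common vector of Gibbs weights.
\<close>

lemma aew_weight_leave_one_out:
  fixes S :: "nat \<Rightarrow> 'a \<times> real" and f :: "nat \<Rightarrow> 'a \<Rightarrow> real" and l :: "real \<Rightarrow> real \<Rightarrow> real"
  assumes n: "n \<ge> 1" and i: "i \<in> {1..Suc n}"
  defines "loss k j \<equiv> l (f k (fst (S j))) (snd (S j))"
  shows "aew_weight l M n T f (S \<circ> swap_last n i) k
    = exp (- (((\<Sum>j=1..Suc n. loss k j) - loss k i) / T))
      / (\<Sum>k'=1..M. exp (- (((\<Sum>j=1..Suc n. loss k' j) - loss k' i) / T)))"
proof -
  have exponent: "real n / T * empirical_risk l n (S \<circ> swap_last n i) (f k)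
    = ((\<Sum>j=1..Suc n. loss k j) - loss k i) / T" for k
  proof -
    have "(\<Sum>j=1..n. loss k (swap_last n i j)) + loss k i
      = (\<Sum>j=1..Suc n. loss k (swap_last n i j))"
      by simp
    also have "\<dots> = (\<Sum>j=1..Suc n. loss k j)"
    proof (rule sum.reindex_bij_betw)
      show "bij_betw (swap_last n i) {1..Suc n} {1..Suc n}"
        using i by (intro bij_betwI[where g = "swap_last n i"]) (auto simp: Transposition.transpose_def)
    qed
    finally show ?thesis
      using n unfolding loss_def by (simp add: empirical_risk_def)
  qed
  show ?thesis unfolding aew_weight_def minus_mult_left[symmetric] exponent ..
qed

text \<open>
  Adding point \<open>i\<close> back to the training set is the tilt in \<open>tilted_jensen\<close>, so every held-out loss is
  bounded by an average under the weights of the full configuration. Since these do not depend on \<open>i\<close>,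
  summation over \<open>i\<close> produces the total losses \<open>W\<close>.
\<close>

lemma sum_held_out_loss_le:
  fixes S :: "nat \<Rightarrow> 'a \<times> real"
  assumes tilted: "tilted_jensen Y l T" and T: "T > 0" and n: "n \<ge> 1" and k: "k \<in> {1..M}"
    and Y: "\<And>i. i \<in> {1..Suc n} \<Longrightarrow> snd (S i) \<in> Y"
    and f: "\<And>i k. i \<in> {1..Suc n} \<Longrightarrow> k \<in> {1..M} \<Longrightarrow> f k (fst (S i)) \<in> Y"
  shows "(\<Sum>i=1..Suc n. held_out_loss l M n T f (S \<circ> swap_last n i))
    \<le> (\<Sum>i=1..Suc n. l (f k (fst (S i))) (snd (S i))) + T * ln (real M)"
proof -
  define loss where "loss k j = l (f k (fst (S j))) (snd (S j))" for k j
  define W where "W k = (\<Sum>i=1..Suc n. loss k i)" for k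
  define Z where "Z = (\<Sum>k=1..M. exp (- (W k / T)))"
  have M: "M \<ge> 1" using k by auto
  then have Z: "Z > 0" unfolding Z_def by (intro sum_pos) auto
  have one: "held_out_loss l M n T f (S \<circ> swap_last n i) * Z
    \<le> (\<Sum>k=1..M. exp (- (W k / T)) * loss k i)" if i: "i \<in> {1..Suc n}" for i
  proof -
    define S' where "S' = S \<circ> swap_last n i"
    define \<theta> where "\<theta> k = aew_weight l M n T f S' k" for k
    define D where "D = (\<Sum>k'=1..M. exp (- ((W k' - loss k' i) / T)))"
    have D: "D > 0" unfolding D_def using M by (intro sum_pos) auto
    have \<theta>: "\<theta> k * exp (- (loss k i / T)) = exp (- (W k / T)) / D" for k
      unfolding \<theta>_def S'_def aew_weight_leave_one_out[OF n i] D_def W_def loss_def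
      by (simp add: diff_divide_distrib flip: exp_add)
    have "l (\<Sum>k=1..M. \<theta> k * f k (fst (S i))) (snd (S i)) * (\<Sum>k=1..M. \<theta> k * exp (- (loss k i / T)))
      \<le> (\<Sum>k=1..M. \<theta> k * exp (- (loss k i / T)) * loss k i)"
      unfolding loss_def
      using tilted[unfolded tilted_jensen_def, rule_format, of "snd (S i)" "{1..M}" \<theta> "\<lambda>k. f k (fst (S i))"]
        aew_weight_pos[OF M, of l n T f S'] sum_aew_weight[OF M, of l n T f S'] Y[OF i] f[OF i]
      by (simp add: \<theta>_def less_imp_le)
    also have "l (\<Sum>k=1..M. \<theta> k * f k (fst (S i))) (snd (S i)) = held_out_loss l M n T f S'"
      by (simp add: held_out_loss_def aew_def S'_def \<theta>_def)
    finally have "held_out_loss l M n T f S' * (Z / D) \<le> (\<Sum>k=1..M. exp (- (W k / T)) * loss k i) / D"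
      by (simp add: \<theta> Z_def sum_divide_distrib)
    then show ?thesis using D by (simp add: S'_def divide_le_cancel)
  qed
  have "(\<Sum>i=1..Suc n. held_out_loss l M n T f (S \<circ> swap_last n i)) * Z
    \<le> (\<Sum>i=1..Suc n. \<Sum>k=1..M. exp (- (W k / T)) * loss k i)"
    unfolding sum_distrib_right by (intro sum_mono one)
  also have "\<dots> = (\<Sum>k=1..M. exp (- (W k / T)) * W k)"
    unfolding W_def sum_distrib_left by (rule sum.swap)
  also have "\<dots> \<le> (W k + T * ln (real (card {1..M}))) * Z"
    unfolding Z_def using T k by (intro gibbs_mean_le) auto
  finally have "(\<Sum>i=1..Suc n. held_out_loss l M n T f (S \<circ> swap_last n i)) \<le> W k + T * ln (real M)"
    using Z by (simp add: mult_le_cancel_right)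
  then show ?thesis by (simp add: W_def loss_def)
qed

section \<open>Exchangeability and the expected risk\<close>

text \<open>
  Exchangeability of i.i.d. points. A transposition of \<open>{1..n + 1}\<close> fixes all other indices, so composing
  with it preserves the value \<open>undefined\<close> there and maps the product space to itself.
\<close>

lemma distr_comp_swap_last:
  assumes P: "prob_space P" and i: "i \<in> {1..Suc n}"
  defines "N \<equiv> \<Pi>\<^sub>M i\<in>{1..Suc n}. P"
  shows measurable_comp_swap_last: "(\<lambda>S. S \<circ> swap_last n i) \<in> N \<rightarrow>\<^sub>M N"
    and "distr N N (\<lambda>S. S \<circ> swap_last n i) = N"
proof -
  let ?I = "{1..Suc n}"
  have swap: "swap_last n i \<in> ?I \<rightarrow> ?I" using i by (auto simp: Transposition.transpose_def)
  have eq: "(\<lambda>j\<in>?I. S (swap_last n i j)) = S \<circ> swap_last n i" if "S \<in> space N" for S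
  proof
    have "swap_last n i j = j \<and> S j = undefined" if "j \<notin> ?I" for j
      using that i PiE_arb[of S ?I "\<lambda>_. space P" j] \<open>S \<in> space N\<close>
      by (auto simp: N_def space_PiM Transposition.transpose_def)
    then show "(\<lambda>j\<in>?I. S (swap_last n i j)) j = (S \<circ> swap_last n i) j" for j
      by (metis comp_apply restrict_apply)
  qed
  have "(\<lambda>S. \<lambda>j\<in>?I. S (swap_last n i j)) \<in> N \<rightarrow>\<^sub>M N"
    using swap unfolding N_def by (intro measurable_restrict measurable_component_singleton) auto
  then show "(\<lambda>S. S \<circ> swap_last n i) \<in> N \<rightarrow>\<^sub>M N"
    by (subst (asm) measurable_cong[OF eq])
  have "distr N N (\<lambda>S. S \<circ> swap_last n i) = distr N N (\<lambda>S. \<lambda>j\<in>?I. S (swap_last n i j))"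
    by (intro distr_cong refl eq[symmetric])
  also have "\<dots> = N"
    using distr_PiM_reindex[of ?I "\<lambda>_. P" "swap_last n i" ?I] P swap by (simp add: N_def)
  finally show "distr N N (\<lambda>S. S \<circ> swap_last n i) = N" .
qed

text \<open>
  The held-out losses of the \<open>n + 1\<close> points have the same integral by exchangeability, and Fubini's
  theorem identifies it with the expected risk of the aggregate. Integrating the pointwise bound on
  their sum therefore gives \<open>n + 1\<close> times the claim.
\<close>

lemma aew_oracle_inequality:
  fixes X :: "'a measure" and l :: "real \<Rightarrow> real \<Rightarrow> real"
  assumes Y: "convex Y"
    and l: "case_prod l \<in> borel_measurable (borel_on Y \<Otimes>\<^sub>M borel_on Y)"
    and bounded: "\<And>u y. u \<in> Y \<Longrightarrow> y \<in> Y \<Longrightarrow> \<bar>l u y\<bar> \<le> B"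
    and tilted: "tilted_jensen Y l T" and T: "T > 0" and n: "n \<ge> 1" and M: "M \<ge> 1"
    and f: "\<And>k. k \<in> {1..M} \<Longrightarrow> f k \<in> X \<rightarrow>\<^sub>M borel_on Y"
    and P: "prob_space P" and sets_P: "sets P = sets (X \<Otimes>\<^sub>M borel_on Y)"
  shows "(\<integral>S. risk l P (aew l M n T f S) \<partial>(\<Pi>\<^sub>M i\<in>{1..n}. P))
    \<le> Min ((\<lambda>k. risk l P (f k)) ` {1..M}) + T * ln (real M) / (real n + 1)"
proof -
  interpret P: prob_space P by fact
  let ?N = "\<Pi>\<^sub>M i\<in>{1..Suc n}. P"
  interpret N: prob_space ?N using P by (intro prob_space_PiM) auto
  interpret PP: product_prob_space "\<lambda>_ :: nat. P" "{1..Suc n}" by unfold_locales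
  have space_P: "space P = space X \<times> Y"
    using sets_eq_imp_space_eq[OF sets_P] by (simp add: space_pair_measure space_restrict_space)
  have fst_P: "fst \<in> P \<rightarrow>\<^sub>M X" and snd_P: "snd \<in> P \<rightarrow>\<^sub>M borel_on Y"
    by (simp_all cong: measurable_cong_sets add: measurable_cong_sets[OF sets_P refl])
  have f_Y: "f k x \<in> Y" if "k \<in> {1..M}" "x \<in> space X" for k x
    using measurable_space[OF f[OF that(1)] that(2)] by (simp add: space_restrict_space)
  have l_comp: "(\<lambda>\<omega>. l (g \<omega>) (h \<omega>)) \<in> borel_measurable \<Omega>"
    if "g \<in> \<Omega> \<rightarrow>\<^sub>M borel_on Y" "h \<in> \<Omega> \<rightarrow>\<^sub>M borel_on Y" for g h and \<Omega> :: "'c measure"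
    using measurable_compose[OF measurable_Pair[OF that] l] by simp
  have proj: "(\<lambda>S. S i) \<in> ?N \<rightarrow>\<^sub>M P" if "i \<in> {1..Suc n}" for i
    using that by (rule measurable_component_singleton)
  have S_in: "fst (S i) \<in> space X \<and> snd (S i) \<in> Y" if "S \<in> space ?N" "i \<in> {1..Suc n}" for S i
    using measurable_space[OF proj[OF that(2)] that(1)] by (auto simp: space_P)

  have fk: "(\<lambda>S. f k (fst (S i))) \<in> ?N \<rightarrow>\<^sub>M borel_on Y"
    if "k \<in> {1..M}" "i \<in> {1..Suc n}" for k i
    by (intro measurable_compose[OF measurable_compose[OF proj fst_P] f] that)
  have sndS: "(\<lambda>S. snd (S i)) \<in> ?N \<rightarrow>\<^sub>M borel_on Y" if "i \<in> {1..Suc n}" for i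
    by (intro measurable_compose[OF proj snd_P] that)
  have loss_S: "(\<lambda>S. l (f k (fst (S i))) (snd (S i))) \<in> borel_measurable ?N"
    if "k \<in> {1..M}" "i \<in> {1..Suc n}" for k i
    by (intro l_comp fk sndS that)
  have loss_S_int: "integrable ?N (\<lambda>S. l (f k (fst (S i))) (snd (S i)))"
    if "k \<in> {1..M}" "i \<in> {1..Suc n}" for k i
  proof (rule N.integrable_const_bound[where B = B])
    show "AE S in ?N. norm (l (f k (fst (S i))) (snd (S i))) \<le> B"
      using bounded f_Y S_in that by (intro AE_I2) auto
  qed (rule loss_S[OF that])

  have weight: "(\<lambda>S. aew_weight l M n T f S k) \<in> borel_measurable ?N" if "k \<in> {1..M}" for k
    unfolding aew_weight_def empirical_risk_def using that
    by (intro borel_measurable_divide borel_measurable_exp borel_measurable_times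
        borel_measurable_sum borel_measurable_const measurable_compose[OF _ borel_measurable_exp] loss_S) auto
  have aew: "(\<lambda>S. aew l M n T f S (fst (S (Suc n)))) \<in> ?N \<rightarrow>\<^sub>M borel_on Y"
  proof (rule measurable_restrict_space2)
    show "(\<lambda>S. aew l M n T f S (fst (S (Suc n)))) \<in> space ?N \<rightarrow> Y"
      using S_in f_Y by (auto intro!: aew_mem_convex Y M)
    have "(\<lambda>S. f k (fst (S (Suc n)))) \<in> borel_measurable ?N" if "k \<in> {1..M}" for k
      using fk[OF that, of "Suc n"] by (simp add: measurable_restrict_space2_iff)
    then show "(\<lambda>S. aew l M n T f S (fst (S (Suc n)))) \<in> borel_measurable ?N"
      unfolding aew_def using weight by (intro borel_measurable_sum borel_measurable_times) auto
  qed
  define G where "G = held_out_loss l M n T f"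
  have G: "G \<in> borel_measurable ?N"
    unfolding G_def held_out_loss_def by (intro l_comp aew sndS) auto
  have G_swap: "G (S \<circ> swap_last n i) = l (aew l M n T f (S \<circ> swap_last n i) (fst (S i))) (snd (S i))"
    for S i by (simp add: G_def held_out_loss_def)
  have G_swap_meas: "(\<lambda>S. G (S \<circ> swap_last n i)) \<in> borel_measurable ?N" if "i \<in> {1..Suc n}" for i
    using measurable_compose[OF measurable_comp_swap_last[OF P that] G] .
  have G_swap_integral: "(\<integral>S. G (S \<circ> swap_last n i) \<partial>?N) = (\<integral>S. G S \<partial>?N)" if "i \<in> {1..Suc n}" for i
    using integral_distr[OF measurable_comp_swap_last[OF P that] G]
    unfolding distr_comp_swap_last(2)[OF P that] ..
  have G_int: "integrable ?N (\<lambda>S. G (S \<circ> swap_last n i))" if i: "i \<in> {1..Suc n}" for i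
  proof (rule N.integrable_const_bound[where B = B])
    show "AE S in ?N. norm (G (S \<circ> swap_last n i)) \<le> B"
      unfolding G_swap using bounded f_Y S_in i
      by (intro AE_I2) (auto intro!: bounded aew_mem_convex Y M)
  qed (rule G_swap_meas[OF i])

  \<comment> \<open>Integrating out the last of \<open>n + 1\<close> points first turns the held-out loss into the risk.\<close>
  have "(\<integral>S. G S \<partial>?N) = (\<integral>S. G S \<partial>(\<Pi>\<^sub>M i\<in>insert (Suc n) {1..n}. P))"
    by (simp add: atLeastAtMostSuc_conv)
  also have "\<dots> = (\<integral>S. \<integral>z. G (S(Suc n := z)) \<partial>P \<partial>(\<Pi>\<^sub>M i\<in>{1..n}. P))"
    using G_int[of "Suc n"]
    by (intro PP.product_integral_insert) (simp_all add: atLeastAtMostSuc_conv)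
  also have "\<dots> = (\<integral>S. risk l P (aew l M n T f S) \<partial>(\<Pi>\<^sub>M i\<in>{1..n}. P))"
  proof -
    have "aew l M n T f (S(Suc n := z)) = aew l M n T f S" for S z
    proof -
      have "empirical_risk l n (S(Suc n := z)) = empirical_risk l n S"
        unfolding empirical_risk_def by (intro ext arg_cong2[where f="(*)"] sum.cong) auto
      then show ?thesis by (simp add: aew_def aew_weight_def)
    qed
    then show ?thesis by (simp add: G_def held_out_loss_def risk_def)
  qed
  finally have risk_aew: "(\<integral>S. risk l P (aew l M n T f S) \<partial>(\<Pi>\<^sub>M i\<in>{1..n}. P)) = (\<integral>S. G S \<partial>?N)" ..

  have risk_f: "(\<integral>S. l (f k (fst (S i))) (snd (S i)) \<partial>?N) = risk l P (f k)"
    if "k \<in> {1..M}" "i \<in> {1..Suc n}" for k i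
  proof -
    have "risk l P (f k) = (\<integral>z. l (f k (fst z)) (snd z) \<partial>distr ?N P (\<lambda>S. S i))"
      unfolding risk_def using PP.PiM_component[OF that(2)] by simp
    also have "\<dots> = (\<integral>S. l (f k (fst (S i))) (snd (S i)) \<partial>?N)"
      by (intro integral_distr proj that l_comp snd_P measurable_compose[OF fst_P f])
    finally show ?thesis ..
  qed

  have main: "(\<integral>S. G S \<partial>?N) \<le> risk l P (f k) + T * ln (real M) / (real n + 1)" if k: "k \<in> {1..M}" for k
  proof -
    have loss_int: "integrable ?N (\<lambda>S. \<Sum>i=1..Suc n. l (f k (fst (S i))) (snd (S i)))"
      by (intro Bochner_Integration.integrable_sum loss_S_int k)
    have sums_int:
      "integrable ?N (\<lambda>S. \<Sum>i=1..Suc n. G (S \<circ> swap_last n i))"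
      "integrable ?N (\<lambda>S. (\<Sum>i=1..Suc n. l (f k (fst (S i))) (snd (S i))) + T * ln (real M))"
      by (intro Bochner_Integration.integrable_sum Bochner_Integration.integrable_add
          N.integrable_const loss_int G_int; assumption)+
    have "(real n + 1) * (\<integral>S. G S \<partial>?N) = (\<Sum>i=1..Suc n. \<integral>S. G S \<partial>?N)"
      by simp
    also have "\<dots> = (\<Sum>i=1..Suc n. \<integral>S. G (S \<circ> swap_last n i) \<partial>?N)"
      by (intro sum.cong refl G_swap_integral[symmetric])
    also have "\<dots> = (\<integral>S. (\<Sum>i=1..Suc n. G (S \<circ> swap_last n i)) \<partial>?N)"
      using G_int by (intro Bochner_Integration.integral_sum[symmetric]) auto
    also have "\<dots> \<le> (\<integral>S. (\<Sum>i=1..Suc n. l (f k (fst (S i))) (snd (S i))) + T * ln (real M) \<partial>?N)"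
    proof (rule integral_mono)
      fix S assume "S \<in> space ?N"
      then show "(\<Sum>i=1..Suc n. G (S \<circ> swap_last n i))
          \<le> (\<Sum>i=1..Suc n. l (f k (fst (S i))) (snd (S i))) + T * ln (real M)"
        unfolding G_def using S_in f_Y by (intro sum_held_out_loss_le[OF tilted T n k]) auto
    qed (rule sums_int)+
    also have "\<dots> = (\<integral>S. (\<Sum>i=1..Suc n. l (f k (fst (S i))) (snd (S i))) \<partial>?N) + T * ln (real M)"
      by (subst Bochner_Integration.integral_add[OF loss_int N.integrable_const])
         (use N.prob_space in \<open>simp del: sum.cl_ivl_Suc\<close>)
    also have "(\<integral>S. (\<Sum>i=1..Suc n. l (f k (fst (S i))) (snd (S i))) \<partial>?N)
        = (\<Sum>i=1..Suc n. \<integral>S. l (f k (fst (S i))) (snd (S i)) \<partial>?N)"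
      by (intro Bochner_Integration.integral_sum loss_S_int k)
    also have "\<dots> = (real n + 1) * risk l P (f k)"
      using risk_f[OF k] by (simp del: sum.cl_ivl_Suc)
    also have "(real n + 1) * risk l P (f k) + T * ln (real M)
        = (real n + 1) * (risk l P (f k) + T * ln (real M) / (real n + 1))"
      by (simp add: field_simps)
    finally show ?thesis by (rule mult_left_le_imp_le) simp
  qed
  have "Min ((\<lambda>k. risk l P (f k)) ` {1..M}) \<in> (\<lambda>k. risk l P (f k)) ` {1..M}"
    using M by (intro Min_in) auto
  then show ?thesis unfolding risk_aew using main by auto
qed

theorem theorem1:
  fixes X :: "'a measure"
  shows
    "(\<forall>(Y :: real set) (l :: real \<Rightarrow> real \<Rightarrow> real) (B :: real) (L :: real) (\<mu> :: real).
        convex Y \<longrightarrow> B > 0 \<longrightarrow> L > 0 \<longrightarrow> \<mu> > 0 \<longrightarrow>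
        case_prod l \<in> borel_measurable (borel_on Y \<Otimes>\<^sub>M borel_on Y) \<longrightarrow>
        (\<forall>u\<in>Y. \<forall>y\<in>Y. 0 \<le> l u y) \<longrightarrow>
        (\<forall>u\<in>Y. \<forall>y\<in>Y. l u y \<le> B) \<longrightarrow>
        (\<forall>y\<in>Y. \<forall>u\<in>Y. \<forall>v\<in>Y. \<bar>l u y - l v y\<bar> \<le> L * \<bar>u - v\<bar>) \<longrightarrow>
        (\<forall>y\<in>Y. convex_on Y (\<lambda>u. l u y - \<mu> / 2 * u\<^sup>2)) \<longrightarrow>
        (\<forall>(M :: nat) (n :: nat) (T :: real) (f :: nat \<Rightarrow> 'a \<Rightarrow> real) (P :: ('a \<times> real) measure).
           M \<ge> 1 \<longrightarrow> n \<ge> 1 \<longrightarrow> T > 0 \<longrightarrow> L\<^sup>2 / T * exp (B / T) \<le> \<mu> / 2 \<longrightarrow>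
           (\<forall>k\<in>{1..M}. f k \<in> X \<rightarrow>\<^sub>M borel_on Y) \<longrightarrow>
           prob_space P \<longrightarrow> sets P = sets (X \<Otimes>\<^sub>M borel_on Y) \<longrightarrow>
           (\<integral>S. risk l P (aew l M n T f S) \<partial>(\<Pi>\<^sub>M i\<in>{1..n}. P))
             \<le> Min ((\<lambda>k. risk l P (f k)) ` {1..M}) + T * ln (real M) / (real n + 1)))
     \<and>
     (\<forall>(b :: real) (l :: real \<Rightarrow> real \<Rightarrow> real).
        b > 0 \<longrightarrow> l = (\<lambda>u y. (u - y)\<^sup>2) \<longrightarrow>
        (\<forall>(M :: nat) (n :: nat) (T :: real) (f :: nat \<Rightarrow> 'a \<Rightarrow> real) (P :: ('a \<times> real) measure).
           M \<ge> 1 \<longrightarrow> n \<ge> 1 \<longrightarrow> T \<ge> 4 * b\<^sup>2 \<longrightarrow>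
           (\<forall>k\<in>{1..M}. f k \<in> X \<rightarrow>\<^sub>M borel_on {0..b}) \<longrightarrow>
           prob_space P \<longrightarrow> sets P = sets (X \<Otimes>\<^sub>M borel_on {0..b}) \<longrightarrow>
           (\<integral>S. risk l P (aew l M n T f S) \<partial>(\<Pi>\<^sub>M i\<in>{1..n}. P))
             \<le> Min ((\<lambda>k. risk l P (f k)) ` {1..M}) + T * ln (real M) / (real n + 1)))"
proof (intro conjI allI impI)
  fix Y :: "real set" and l :: "real \<Rightarrow> real \<Rightarrow> real" and B L \<mu> T :: real and M n :: nat
    and f :: "nat \<Rightarrow> 'a \<Rightarrow> real" and P :: "('a \<times> real) measure"
  assume Y: "convex Y" and "\<mu> > 0"
    and l: "case_prod l \<in> borel_measurable (borel_on Y \<Otimes>\<^sub>M borel_on Y)"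
    and nonneg: "\<forall>u\<in>Y. \<forall>y\<in>Y. 0 \<le> l u y" and bounded: "\<forall>u\<in>Y. \<forall>y\<in>Y. l u y \<le> B"
    and lipschitz: "\<forall>y\<in>Y. \<forall>u\<in>Y. \<forall>v\<in>Y. \<bar>l u y - l v y\<bar> \<le> L * \<bar>u - v\<bar>"
    and convex: "\<forall>y\<in>Y. convex_on Y (\<lambda>u. l u y - \<mu> / 2 * u\<^sup>2)"
    and Mn: "M \<ge> 1" "n \<ge> 1" and T: "T > 0" "L\<^sup>2 / T * exp (B / T) \<le> \<mu> / 2"
    and f: "\<forall>k\<in>{1..M}. f k \<in> X \<rightarrow>\<^sub>M borel_on Y"
    and P: "prob_space P" "sets P = sets (X \<Otimes>\<^sub>M borel_on Y)"
  have "tilted_jensen Y l T"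
    by (rule tilted_jensen_if_strongly_convex[OF Y, of l B L \<mu>])
       (use nonneg bounded lipschitz convex \<open>\<mu> > 0\<close> T in auto)
  moreover have "\<bar>l u y\<bar> \<le> B" if "u \<in> Y" "y \<in> Y" for u y
    using nonneg bounded that by auto
  ultimately show "(\<integral>S. risk l P (aew l M n T f S) \<partial>(\<Pi>\<^sub>M i\<in>{1..n}. P))
      \<le> Min ((\<lambda>k. risk l P (f k)) ` {1..M}) + T * ln (real M) / (real n + 1)"
    using Y l T Mn f P by (intro aew_oracle_inequality[where Y = Y and B = B and X = X]) auto
next
  fix b T :: real and l :: "real \<Rightarrow> real \<Rightarrow> real" and M n :: nat
    and f :: "nat \<Rightarrow> 'a \<Rightarrow> real" and P :: "('a \<times> real) measure"
  assume b: "b > 0" and l: "l = (\<lambda>u y. (u - y)\<^sup>2)"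
    and Mn: "M \<ge> 1" "n \<ge> 1" and T: "4 * b\<^sup>2 \<le> T"
    and f: "\<forall>k\<in>{1..M}. f k \<in> X \<rightarrow>\<^sub>M borel_on {0..b}"
    and P: "prob_space P" "sets P = sets (X \<Otimes>\<^sub>M borel_on {0..b})"
  have "0 < 4 * b\<^sup>2" using b by simp
  then have "T > 0" using T by linarith
  have "\<bar>l u y\<bar> \<le> b\<^sup>2" if "u \<in> {0..b}" "y \<in> {0..b}" for u y
  proof -
    have "\<bar>u - y\<bar>\<^sup>2 \<le> b\<^sup>2" using that by (intro power_mono) auto
    then show ?thesis by (simp add: l)
  qed
  moreover have "case_prod l \<in> borel_measurable (borel_on {0..b} \<Otimes>\<^sub>M borel_on {0..b})"
  proof -
    have id: "(\<lambda>u. u) \<in> borel_on {0..b} \<rightarrow>\<^sub>M (borel :: real measure)"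
      by (intro measurable_restrict_space1) simp
    show ?thesis
      unfolding l case_prod_beta
      by (intro borel_measurable_power borel_measurable_diff
          measurable_compose[OF measurable_fst id] measurable_compose[OF measurable_snd id])
  qed
  moreover have "tilted_jensen {0..b} l T"
    unfolding l using b T by (rule tilted_jensen_square)
  ultimately show "(\<integral>S. risk l P (aew l M n T f S) \<partial>(\<Pi>\<^sub>M i\<in>{1..n}. P))
      \<le> Min ((\<lambda>k. risk l P (f k)) ` {1..M}) + T * ln (real M) / (real n + 1)"
    using \<open>T > 0\<close> Mn f P
    by (intro aew_oracle_inequality[where Y = "{0..b}" and B = "b\<^sup>2" and X = X]) auto
qed

end
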